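(* Let $V:\mathcal S_0^n\longrightarrow \mathbb R$ be a rotationally invariant radial continuous valuation on the $n$-dimensional star bodies $\mathcal S_0^n$. Then there exists a continuous function $\theta:[0,\infty)\longrightarrow\mathbb R$ such that, for every $K\in\mathcal S_0^n$, $$V(K)=\int_{S^{n-1}}\theta(\rho_K(t))\,dm(t),$$ where $\rho_K$ is the radial function of $K$ and $m$ is the Lebesgue measure on $S^{n-1}$ normalized so that $m(S^{n-1})=1$. Conversely, let $\theta:[0,\infty)\longrightarrow\mathbb R$ be a continuous function. Then the map $V:\mathcal S_0^n\longrightarrow\mathbb R$ given by $$V(K)=\int_{S^{n-1}}\theta(\rho_K(t))\,dm(t)$$ is a radial continuous rotationally invariant valuation.
   Context: A set $L\subset\mathbb R^n$ is a star set if it contains the origin and every line through $0$ that meets $L$ does so in a (possibly degenerate) closed line segment. Its radial function is $\rho_L(t)=\sup\{c\ge 0: ct\in L\}$, considered as a function on the Euclidean unit sphere $S^{n-1}\subset\mathbb R^n$. A star set $L$ is a star body if $\rho_L$ is continuous on $S^{n-1}$; $\mathcal S_0^n$ denotes the set of all $n$-dimensional star bodies, that is, star bodies in $\mathbb R^n$. Star bodies correspond, via their radial functions, to the continuous functions $S^{n-1}\to[0,\infty)$, and $\rho_{K\cup L}=\max(\rho_K,\rho_L)$, $\rho_{K\cap L}=\min(\rho_K,\rho_L)$; in particular $K\cup L, K\cap L\in\mathcal S_0^n$ for $K,L\in\mathcal S_0^n$. The radial sum $K\tilde{+}L$ is the star set with radial function $\rho_K+\rho_L$. The radial metric on $\mathcal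 S_0^n$ is $\delta(K,L)=\inf\{\lambda\ge 0: K\subset L\tilde{+}\lambda B_n,\ L\subset K\tilde{+}\lambda B_n\}=\|\rho_K-\rho_L\|_\infty$, where $B_n$ is the Euclidean unit ball of $\mathbb R^n$. "Radial continuous" means continuous with respect to $\delta$. A map $V:\mathcal S_0^n\to\mathbb R$ is a valuation if $V(K\cup L)+V(K\cap L)=V(K)+V(L)$ for all $K,L\in\mathcal S_0^n$. It is rotationally invariant if its value does not change when a star body is rotated, i.e. $V(\varphi(K))=V(K)$ for every $K\in\mathcal S_0^n$ and every rotation $\varphi$ of $\mathbb R^n$ about the origin.
   Formalization: The representation part is stated for n ≥ 2: for n = 1 the only rotation is the identity, and V(K) = ρ_K(1) is a rotationally invariant radial continuous valuation not of the claimed integral form; the converse is stated for all n ≥ 1. *)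

theory Defs
  imports "HOL-Analysis.Analysis"
begin

definition star_set :: "(real^'n) set \<Rightarrow> bool" where
  "star_set L \<longleftrightarrow>
     0 \<in> L \<and>
     (\<forall>x. x \<noteq> 0 \<and> L \<inter> span {x} \<noteq> {} \<longrightarrow> (\<exists>a b. L \<inter> span {x} = closed_segment a b))"

definition radial_function :: "(real^'n) set \<Rightarrow> real^'n \<Rightarrow> real" where
  "radial_function L t = Sup {c. 0 \<le> c \<and> c *\<^sub>R t \<in> L}"

definition star_bodies :: "(real^'n) set set" where
  "star_bodies = {L. star_set L \<and> continuous_on (sphere 0 1) (radial_function L)}"

text \<open>
  A star set is determined by its radial function, so the description is unique;
  well-definedness for star sets is shown in lemma \<open>radial_sum\<close> below.
\<close>
definition radial_sum :: "(real^'n) set \<Rightarrow> (real^'n) set \<Rightarrow> (real^'n) set" where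
  "radial_sum K L =
     (THE M. star_set M \<and>
        (\<forall>t\<in>sphere 0 1. radial_function M t = radial_function K t + radial_function L t))"

definition radial_dist :: "(real^'n) set \<Rightarrow> (real^'n) set \<Rightarrow> real" where
  "radial_dist K L =
     Inf {r. 0 \<le> r \<and>
        K \<subseteq> radial_sum L ((*\<^sub>R) r ` cball 0 1) \<and>
        L \<subseteq> radial_sum K ((*\<^sub>R) r ` cball 0 1)}"

definition radial_continuous :: "((real^'n) set \<Rightarrow> real) \<Rightarrow> bool" where
  "radial_continuous V \<longleftrightarrow>
     (\<forall>K\<in>star_bodies. \<forall>e>0. \<exists>d>0. \<forall>L\<in>star_bodies. radial_dist K L < d \<longrightarrow> \<bar>V L - V K\<bar> < e)"

definition valuation :: "((real^'n) set \<Rightarrow> real) \<Rightarrow> bool" where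
  "valuation V \<longleftrightarrow>
     (\<forall>K\<in>star_bodies. \<forall>L\<in>star_bodies. V (K \<union> L) + V (K \<inter> L) = V K + V L)"

text \<open>
  Rotations are the elements of SO(n).
\<close>
definition rotation_invariant :: "((real^'n) set \<Rightarrow> real) \<Rightarrow> bool" where
  "rotation_invariant V \<longleftrightarrow>
     (\<forall>K\<in>star_bodies. \<forall>A. rotation_matrix A \<longrightarrow> V ((*v) A ` K) = V K)"

text \<open>
  Lebesgue (surface) measure on the unit sphere, given by the cone construction:
  a Borel set \<open>E\<close> of the sphere has measure \<open>n\<close> times the volume of
  \<open>{r *\<^sub>R t | r t. 0 < r \<and> r \<le> 1 \<and> t \<in> E}\<close>.
  This is the measure appearing in integration in polar coordinates.
\<close>
definition surface_measure :: "(real^'n) measure" where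
  "surface_measure =
     scale_measure (of_nat CARD('n))
       (distr (restrict_space lborel (cball 0 1 - {0}))
              (restrict_space borel (sphere 0 1))
              (\<lambda>x. x /\<^sub>R norm x))"

definition normalized_surface_measure :: "(real^'n) measure" where
  "normalized_surface_measure = uniform_measure surface_measure (sphere 0 1)"

lemma star_set_ray:
  fixes L :: "(real^'n) set"
  assumes L: "star_set L" and t: "t \<in> sphere 0 1"
  shows "{c. 0 \<le> c \<and> c *\<^sub>R t \<in> L} = {0..radial_function L t}"
    and "0 \<le> radial_function L t"
proof -
  define S where "S = {c. 0 \<le> c \<and> c *\<^sub>R t \<in> L}"
  have nt: "norm t = 1" and t0: "t \<noteq> 0" using t by auto
  have 0: "0 \<in> L" using L by (simp add: star_set_def)
  have "L \<inter> span {t} \<noteq> {}" using 0 span_zero by blast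
  then obtain a b where ab: "L \<inter> span {t} = closed_segment a b"
    using L t0 unfolding star_set_def by meson
  have S: "S = {0..} \<inter> (\<lambda>c. c *\<^sub>R t) -` closed_segment a b"
    unfolding ab[symmetric] S_def by (auto simp: span_singleton)
  have cl: "closed S" unfolding S
    by (intro closed_Int closed_atLeast closed_vimage closed_segment continuous_intros)
  obtain B where B: "\<And>x. x \<in> closed_segment a b \<Longrightarrow> norm x \<le> B"
    using bounded_closed_segment[of a b] by (auto simp: bounded_iff)
  have bd: "bdd_above S"
    by (rule bdd_aboveI[of _ B]) (use B nt in \<open>fastforce simp: S\<close>)
  have S0: "0 \<in> S" using 0 by (simp add: S_def)
  have Sup: "Sup S \<in> S" using closed_contains_Sup[OF _ bd cl] S0 by blast
  have rf: "radial_function L t = Sup S" by (simp add: radial_function_def S_def)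
  show "0 \<le> radial_function L t" using Sup by (simp add: rf S_def)
  have cv: "convex S" unfolding S
    by (intro convex_Int convex_real_interval convex_linear_vimage convex_closed_segment)
       (simp add: linear_iff algebra_simps)
  have "{0..Sup S} \<subseteq> S"
    using closed_segment_subset[OF S0 Sup cv] Sup by (simp add: closed_segment_eq_real_ivl S_def)
  moreover have "S \<subseteq> {0..Sup S}" using bd by (auto simp: S_def intro: cSup_upper)
  ultimately show "{c. 0 \<le> c \<and> c *\<^sub>R t \<in> L} = {0..radial_function L t}"
    by (simp add: rf S_def[symmetric])
qed

lemma star_set_eq:
  fixes L :: "(real^'n) set"
  assumes L: "star_set L"
  shows "L = {c *\<^sub>R t | c t. t \<in> sphere 0 1 \<and> 0 \<le> c \<and> c \<le> radial_function L t}"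
proof (intro equalityI subsetI)
  fix x assume x: "x \<in> L"
  obtain t :: "real^'n" where t: "t \<in> sphere 0 1" "x = norm x *\<^sub>R t"
  proof (cases "x = 0")
    case True
    obtain b :: "real^'n" where "b \<in> Basis" using nonempty_Basis by blast
    then show ?thesis using that[of b] True by simp
  next
    case False
    then show ?thesis using that[of "x /\<^sub>R norm x"] by simp
  qed
  then have "norm x \<in> {c. 0 \<le> c \<and> c *\<^sub>R t \<in> L}" using x by simp
  then have "norm x \<le> radial_function L t" using star_set_ray(1)[OF L t(1)] by auto
  then show "x \<in> {c *\<^sub>R t | c t. t \<in> sphere 0 1 \<and> 0 \<le> c \<and> c \<le> radial_function L t}"
    using t by (metis (mono_tags, lifting) mem_Collect_eq norm_ge_zero)
next
  fix x assume "x \<in> {c *\<^sub>R t | c t. t \<in> sphere 0 1 \<and> 0 \<le> c \<and> c \<le> radial_function L t}"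
  then obtain c t where "x = c *\<^sub>R t" "t \<in> sphere 0 1" "c \<in> {0..radial_function L t}" by auto
  then show "x \<in> L" using star_set_ray(1)[OF L] by blast
qed

lemma star_set_of_radial:
  fixes f :: "real^'n \<Rightarrow> real"
  assumes f: "\<And>t. t \<in> sphere 0 1 \<Longrightarrow> 0 \<le> f t"
  defines "M \<equiv> {c *\<^sub>R t | c t. t \<in> sphere 0 1 \<and> 0 \<le> c \<and> c \<le> f t}"
  shows "star_set M" and "t \<in> sphere 0 1 \<Longrightarrow> radial_function M t = f t"
proof -
  have ray: "c *\<^sub>R t \<in> M \<longleftrightarrow> c \<le> f t" if "t \<in> sphere 0 1" "0 \<le> c" for c and t :: "real^'n"
  proof
    assume "c *\<^sub>R t \<in> M"
    then obtain d s where d: "c *\<^sub>R t = d *\<^sub>R s" "s \<in> sphere 0 1" "0 \<le> d" "d \<le> f s"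
      by (auto simp: M_def)
    then have "norm (c *\<^sub>R t) = norm (d *\<^sub>R s)" by simp
    then have "c * norm t = d * norm s" using that d(3) by (simp only: norm_scaleR abs_of_nonneg)
    then have "c = d" using that d by simp
    then show "c \<le> f t" using d that f by (cases "c = 0") auto
  qed (use that in \<open>auto simp: M_def\<close>)
  show "radial_function M t = f t" if t: "t \<in> sphere 0 1"
  proof -
    have "{c. 0 \<le> c \<and> c *\<^sub>R t \<in> M} = {0..f t}" using ray[OF t] by auto
    then show ?thesis using f[OF t] by (simp add: radial_function_def)
  qed
  obtain b :: "real^'n" where b: "b \<in> Basis" using nonempty_Basis by blast
  then have M0: "0 \<in> M" using ray[of b 0] f[of b] by simp
  have "\<exists>a b. M \<inter> span {x} = closed_segment a b" if "x \<noteq> 0" for x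
  proof -
    define u where "u = x /\<^sub>R norm x"
    have u: "u \<in> sphere 0 1" and mu: "-u \<in> sphere 0 1" using that by (auto simp: u_def)
    have sp: "span {x} = range (\<lambda>c. c *\<^sub>R u)"
    proof -
      have "span {u} = span {x}" unfolding u_def
        using that span_image_scale[of "{x}" "\<lambda>_. inverse (norm x)"] by simp
      then show ?thesis by (simp add: span_singleton)
    qed
    have *: "c *\<^sub>R u \<in> M \<longleftrightarrow> - f (-u) \<le> c \<and> c \<le> f u" for c
      using ray[OF u, of c] ray[OF mu, of "-c"] f[OF u] f[OF mu] by (cases "0 \<le> c") auto
    have "M \<inter> span {x} = (\<lambda>c. c *\<^sub>R u) ` {- f (-u)..f u}"
    proof (intro equalityI subsetI)
      fix y assume "y \<in> M \<inter> span {x}"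
      then obtain c where c: "y = c *\<^sub>R u" "c *\<^sub>R u \<in> M" unfolding sp by blast
      from c(2) have "c \<in> {- f (-u)..f u}" unfolding * by simp
      with c(1) show "y \<in> (\<lambda>c. c *\<^sub>R u) ` {- f (-u)..f u}" by (rule image_eqI)
    next
      fix y assume "y \<in> (\<lambda>c. c *\<^sub>R u) ` {- f (-u)..f u}"
      then obtain c where c: "y = c *\<^sub>R u" "c \<in> {- f (-u)..f u}" by (rule imageE)
      from c(2) have "c *\<^sub>R u \<in> M" unfolding * by simp
      with c(1) show "y \<in> M \<inter> span {x}" unfolding sp by blast
    qed
    also have "{- f (-u)..f u} = closed_segment (- f (-u)) (f u)"
      by (rule closed_segment_eq_real_ivl1[symmetric]) (use f[OF u] f[OF mu] in linarith)
    also have "(\<lambda>c. c *\<^sub>R u) ` \<dots> = closed_segment (- f (-u) *\<^sub>R u) (f u *\<^sub>R u)"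
      by (rule closed_segment_linear_image[symmetric]) (simp add: linear_iff scaleR_add_left)
    finally show ?thesis by blast
  qed
  with M0 show "star_set M" unfolding star_set_def by blast
qed

lemma radial_sum:
  fixes K L :: "(real^'n) set"
  assumes "star_set K" "star_set L"
  shows "star_set (radial_sum K L)"
    and "t \<in> sphere 0 1 \<Longrightarrow>
      radial_function (radial_sum K L) t = radial_function K t + radial_function L t"
proof -
  let ?P = "\<lambda>M. star_set M \<and>
     (\<forall>t\<in>sphere 0 1. radial_function M t = radial_function K t + radial_function L t)"
  have nn: "0 \<le> radial_function K t + radial_function L t" if "t \<in> sphere 0 1" for t
    using star_set_ray(2)[OF _ that] assms by (simp add: add_nonneg_nonneg)
  have "\<exists>M. ?P M"
    using star_set_of_radial[of "\<lambda>t. radial_function K t + radial_function L t", OF nn] by blast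
  moreover have "M = N" if M: "?P M" and N: "?P N" for M N
  proof -
    have eq: "radial_function M t = radial_function N t" if "t \<in> sphere 0 1" for t
      using M N that by simp
    have "{c *\<^sub>R t | c t. t \<in> sphere 0 1 \<and> 0 \<le> c \<and> c \<le> radial_function M t} =
          {c *\<^sub>R t | c t. t \<in> sphere 0 1 \<and> 0 \<le> c \<and> c \<le> radial_function N t}"
      using eq by (intro Collect_cong ex_cong1 conj_cong refl) simp
    then show ?thesis using star_set_eq[of M] star_set_eq[of N] M N by simp
  qed
  ultimately have "\<exists>!M. ?P M" by blast
  from theI'[OF this] have P: "?P (radial_sum K L)" unfolding radial_sum_def .
  show "star_set (radial_sum K L)" using P by blast
  show "t \<in> sphere 0 1 \<Longrightarrow>
      radial_function (radial_sum K L) t = radial_function K t + radial_function L t"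
    using P by blast
qed

lemma star_set_subset_iff:
  fixes K L :: "(real^'n) set"
  assumes "star_set K" "star_set L"
  shows "K \<subseteq> L \<longleftrightarrow> (\<forall>t\<in>sphere 0 1. radial_function K t \<le> radial_function L t)"
proof
  assume KL: "K \<subseteq> L"
  show "\<forall>t\<in>sphere 0 1. radial_function K t \<le> radial_function L t"
  proof
    fix t :: "real^'n" assume t: "t \<in> sphere 0 1"
    have "{c. 0 \<le> c \<and> c *\<^sub>R t \<in> K} \<subseteq> {c. 0 \<le> c \<and> c *\<^sub>R t \<in> L}" using KL by blast
    then show "radial_function K t \<le> radial_function L t"
      unfolding star_set_ray(1)[OF assms(1) t] star_set_ray(1)[OF assms(2) t]
      using star_set_ray(2)[OF assms(1) t] by simp
  qed
next
  assume le: "\<forall>t\<in>sphere 0 1. radial_function K t \<le> radial_function L t"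
  show "K \<subseteq> L"
  proof
    fix x assume "x \<in> K"
    then obtain c t where x: "x = c *\<^sub>R t" "t \<in> sphere 0 1" "0 \<le> c" "c \<le> radial_function K t"
      using star_set_eq[OF assms(1)] by blast
    then have "c \<in> {0..radial_function L t}" using le by force
    then show "x \<in> L" using star_set_ray(1)[OF assms(2) x(2)] x(1) by blast
  qed
qed

lemma star_set_scaled_ball:
  assumes r: "0 \<le> r"
  shows "star_set ((*\<^sub>R) r ` cball 0 1 :: (real^'n) set)"
    and "t \<in> sphere 0 1 \<Longrightarrow> radial_function ((*\<^sub>R) r ` cball 0 1 :: (real^'n) set) t = r"
proof -
  have "(*\<^sub>R) r ` cball (0::real^'n) 1 = cball 0 r"
    using r by (cases "r = 0") (auto simp: cball_scale image_iff intro!: exI[of _ 0])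
  also have "\<dots> = {c *\<^sub>R t | c t. t \<in> sphere 0 1 \<and> 0 \<le> c \<and> c \<le> r}"
  proof (intro equalityI subsetI)
    fix x :: "real^'n" assume x: "x \<in> cball 0 r"
    obtain t :: "real^'n" where "t \<in> sphere 0 1" "x = norm x *\<^sub>R t"
    proof (cases "x = 0")
      case True
      obtain b :: "real^'n" where "b \<in> Basis" using nonempty_Basis by blast
      then show ?thesis using that[of b] True by simp
    next
      case False
      then show ?thesis using that[of "x /\<^sub>R norm x"] by simp
    qed
    then show "x \<in> {c *\<^sub>R t | c t. t \<in> sphere 0 1 \<and> 0 \<le> c \<and> c \<le> r}"
      using x by (metis (mono_tags, lifting) mem_Collect_eq mem_cball_0 norm_ge_zero)
  qed auto
  finally have eq: "(*\<^sub>R) r ` cball (0::real^'n) 1 =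
      {c *\<^sub>R t | c t. t \<in> sphere 0 1 \<and> 0 \<le> c \<and> c \<le> r}" .
  show "star_set ((*\<^sub>R) r ` cball 0 1 :: (real^'n) set)"
    unfolding eq by (rule star_set_of_radial) (rule r)
  show "t \<in> sphere 0 1 \<Longrightarrow> radial_function ((*\<^sub>R) r ` cball 0 1 :: (real^'n) set) t = r"
    unfolding eq by (rule star_set_of_radial) (rule r)
qed

lemma radial_dist_eq_Sup:
  fixes K L :: "(real^'n) set"
  assumes K: "K \<in> star_bodies" and L: "L \<in> star_bodies"
  shows "radial_dist K L = (SUP t\<in>sphere 0 1. \<bar>radial_function K t - radial_function L t\<bar>)"
proof -
  let ?d = "\<lambda>t. \<bar>radial_function K t - radial_function L t\<bar>"
  have sK: "star_set K" and sL: "star_set L" using K L by (auto simp: star_bodies_def)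
  obtain b :: "real^'n" where b: "b \<in> sphere 0 1"
    using norm_Basis nonempty_Basis by (metis ex_in_conv mem_sphere_0)
  have "continuous_on (sphere 0 1) ?d"
    using K L by (intro continuous_intros) (auto simp: star_bodies_def)
  then have "bdd_above (?d ` sphere 0 1)"
    by (intro bounded_imp_bdd_above compact_imp_bounded compact_continuous_image) auto
  note up = cSUP_upper[OF _ this]
  have "K \<subseteq> radial_sum L ((*\<^sub>R) r ` cball 0 1) \<and> L \<subseteq> radial_sum K ((*\<^sub>R) r ` cball 0 1)
      \<longleftrightarrow> (\<forall>t\<in>sphere 0 1. ?d t \<le> r)" if r: "0 \<le> r" for r
  proof -
    note b = star_set_scaled_ball[OF r]
    show ?thesis
      unfolding star_set_subset_iff[OF sK radial_sum(1)[OF sL b(1)]]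
        star_set_subset_iff[OF sL radial_sum(1)[OF sK b(1)]] ball_conj_distrib[symmetric]
    proof (rule ball_cong[OF refl])
      fix t :: "real^'n" assume t: "t \<in> sphere 0 1"
      show "(radial_function K t \<le> radial_function (radial_sum L ((*\<^sub>R) r ` cball 0 1)) t \<and>
             radial_function L t \<le> radial_function (radial_sum K ((*\<^sub>R) r ` cball 0 1)) t)
          \<longleftrightarrow> ?d t \<le> r"
        unfolding radial_sum(2)[OF sL b(1) t] radial_sum(2)[OF sK b(1) t] b(2)[OF t]
        by linarith
    qed
  qed
  note iff = this
  have "{r. 0 \<le> r \<and> K \<subseteq> radial_sum L ((*\<^sub>R) r ` cball 0 1) \<and>
        L \<subseteq> radial_sum K ((*\<^sub>R) r ` cball 0 1)} = {r. 0 \<le> r \<and> (\<forall>t\<in>sphere 0 1. ?d t \<le> r)}"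
    by (intro Collect_cong conj_cong refl iff)
  also have "\<dots> = {(SUP t\<in>sphere 0 1. ?d t)..}"
  proof (intro equalityI subsetI)
    fix r assume "r \<in> {r. 0 \<le> r \<and> (\<forall>t\<in>sphere 0 1. ?d t \<le> r)}"
    then have "(SUP t\<in>sphere 0 1. ?d t) \<le> r" using b by (intro cSUP_least) blast+
    then show "r \<in> {(SUP t\<in>sphere 0 1. ?d t)..}" by simp
  next
    fix r assume "r \<in> {(SUP t\<in>sphere 0 1. ?d t)..}"
    then have le: "(SUP t\<in>sphere 0 1. ?d t) \<le> r" by simp
    have "?d t \<le> r" if "t \<in> sphere 0 1" for t by (rule order_trans[OF up[OF that] le])
    moreover have "0 \<le> r" by (rule order_trans[OF abs_ge_zero calculation[OF b]])
    ultimately show "r \<in> {r. 0 \<le> r \<and> (\<forall>t\<in>sphere 0 1. ?d t \<le> r)}" by blast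
  qed
  finally show ?thesis by (simp add: radial_dist_def)
qed

lemma space_surface_measure: "space (surface_measure :: (real^'n) measure) = sphere 0 1"
  and sets_surface_measure:
    "sets (surface_measure :: (real^'n) measure) = sets (restrict_space borel (sphere 0 1))"
  by (simp_all add: surface_measure_def space_scale_measure space_restrict_space)

lemma emeasure_surface_measure:
  fixes E :: "(real^'n) set"
  assumes E: "E \<in> sets borel" "E \<subseteq> sphere 0 1"
  shows "emeasure surface_measure E =
    of_nat CARD('n) * emeasure lborel {r *\<^sub>R t | r t. 0 < r \<and> r \<le> 1 \<and> t \<in> E}"
proof -
  let ?R = "restrict_space lborel (cball 0 1 - {0}) :: (real^'n) measure"
  let ?S = "restrict_space borel (sphere 0 1) :: (real^'n) measure"
  let ?p = "\<lambda>x::real^'n. x /\<^sub>R norm x"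
  have "?p \<in> borel_measurable borel" by measurable
  then have "?p \<in> measurable (restrict_space lborel (cball 0 1 - {0})) borel"
    by (intro measurable_restrict_space1) simp
  then have m: "?p \<in> measurable ?R ?S"
    by (intro measurable_restrict_space2) (auto simp: space_restrict_space)
  have ES: "E \<in> sets ?S" using E by (auto simp: sets_restrict_space)
  have cone: "?p -` E \<inter> space ?R = {r *\<^sub>R t | r t. 0 < r \<and> r \<le> 1 \<and> t \<in> E}" (is "?A = ?C")
  proof (intro equalityI subsetI)
    fix x assume x: "x \<in> ?A"
    then have "x = norm x *\<^sub>R ?p x" "0 < norm x" "norm x \<le> 1" "?p x \<in> E"
      by (auto simp: space_restrict_space)
    then show "x \<in> ?C" by blast
  next
    fix x assume "x \<in> ?C"
    then obtain r t where x: "x = r *\<^sub>R t" "0 < r" "r \<le> 1" "t \<in> E" by blast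
    then have "norm t = 1" using E by auto
    with x show "x \<in> ?A" by (auto simp: space_restrict_space)
  qed
  have "emeasure (distr ?R ?S ?p) E = emeasure ?R ?A"
    by (rule emeasure_distr[OF m ES])
  also have "\<dots> = emeasure lborel ?A"
    by (rule emeasure_restrict_space) (auto simp: space_restrict_space)
  finally show ?thesis unfolding cone[symmetric] surface_measure_def by simp
qed

lemma emeasure_normalized_surface_measure:
  "emeasure (normalized_surface_measure :: (real^'n) measure) (sphere 0 1) = 1"
proof -
  have "{r *\<^sub>R t | r t. 0 < r \<and> r \<le> 1 \<and> t \<in> sphere (0::real^'n) 1} = cball 0 1 - {0}" (is "?C = _")
  proof (intro equalityI subsetI)
    fix x :: "real^'n" assume x: "x \<in> cball 0 1 - {0}"
    then have "x = norm x *\<^sub>R (x /\<^sub>R norm x)" "0 < norm x" "norm x \<le> 1" "x /\<^sub>R norm x \<in> sphere 0 1"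
      by auto
    then show "x \<in> ?C" by blast
  qed auto
  then have "emeasure surface_measure (sphere (0::real^'n) 1) =
      of_nat CARD('n) * emeasure lborel (cball (0::real^'n) 1 - {0})"
    by (subst emeasure_surface_measure) auto
  also have "emeasure lborel (cball (0::real^'n) 1 - {0}) = emeasure lborel (cball (0::real^'n) 1)"
    by (subst emeasure_Diff) (auto)
  also have "\<dots> = ennreal (unit_ball_vol CARD('n))"
    using emeasure_cball[of 1 "0::real^'n"] by simp
  finally have e: "emeasure surface_measure (sphere (0::real^'n) 1) =
      ennreal (CARD('n) * unit_ball_vol CARD('n))"
    by (simp add: ennreal_mult ennreal_of_nat_eq_real_of_nat)
  show ?thesis unfolding normalized_surface_measure_def
    by (rule emeasure_uniform_measure_1) (use unit_ball_vol_pos[of "real CARD('n)"] in \<open>simp_all add: e ennreal_eq_0_iff mult_le_0_iff not_le\<close>)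
qed

end

theory Submission
  imports Defs "HOL-Complex_Analysis.Great_Picard" "HOL-Probability.Probability_Measure"
begin

text \<open>
  Given \<open>V\<close>, let \<open>\<theta> c\<close> be the value of \<open>V\<close> at the ball of radius \<open>c\<close>, and let \<open>U\<close> be \<open>V\<close> minus the
  integral valuation of \<open>\<theta>\<close>, regarded as a functional on nonnegative continuous functions on
  the sphere. Then \<open>U\<close> is again a continuous rotation invariant valuation, and it vanishes on
  constants; the claim is \<open>U = 0\<close>. The functions bounded by \<open>M\<close> that have every modulus of
  continuity of a given \<open>f\<close> form a compact family (Arzela--Ascoli) closed under rotations,
  maxima and minima, so \<open>U\<close> attains its maximum there. By modularity the pointwise maximum of
  two maximizers is a maximizer. Since rotations are transitive on the sphere, finite maxima
  of rotated copies of one maximizer come uniformly close to a constant, where \<open>U\<close>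
  vanishes. Hence \<open>U f \<le> 0\<close>, and the same applies to \<open>- U\<close>.
\<close>

section \<open>Invariant modular functionals on the sphere\<close>

abbreviation unit_sphere :: "(real^'n) set" where "unit_sphere \<equiv> sphere 0 1"

section \<open>Radial functions and equicontinuous families of them\<close>

definition radial_maps :: "(real^'n \<Rightarrow> real) set" where
  "radial_maps = {f. continuous_on unit_sphere f \<and> (\<forall>t\<in>unit_sphere. 0 \<le> f t)}"

text \<open>One admissible pair of a modulus of continuity. The final inequality is non-strict so
  that it passes to pointwise limits.\<close>

definition modulus_bound :: "(real^'n \<Rightarrow> real) \<Rightarrow> real \<Rightarrow> real \<Rightarrow> bool" where
  "modulus_bound f r e \<longleftrightarrow>
     (\<forall>u\<in>unit_sphere. \<forall>v\<in>unit_sphere. dist u v \<le> r \<longrightarrow> \<bar>f u - f v\<bar> \<le> e)"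

text \<open>Quantifying over all pairs \<open>(r, e)\<close> valid for \<open>f\<close>, instead of
  building one modulus function, lets every closure property be checked one pair at a time. For
  continuous \<open>f\<close> these pairs make the family uniformly equicontinuous. Values off the
  sphere are left free.\<close>

definition dominated :: "(real^'n \<Rightarrow> real) \<Rightarrow> real \<Rightarrow> (real^'n \<Rightarrow> real) set" where
  "dominated f M = {g. (\<forall>t\<in>unit_sphere. 0 \<le> g t \<and> g t \<le> M) \<and>
     (\<forall>r e. modulus_bound f r e \<longrightarrow> modulus_bound g r e)}"

lemma modulus_bound_exists:
  fixes f :: "real^'n \<Rightarrow> real"
  assumes "continuous_on unit_sphere f" "0 < e"
  obtains r where "0 < r" "modulus_bound f r e"
proof -
  have "uniformly_continuous_on unit_sphere f"
    using assms(1) by (simp add: compact_uniformly_continuous)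
  then obtain d where d: "0 < d"
    "\<And>u v. \<lbrakk>u \<in> unit_sphere; v \<in> unit_sphere; dist v u < d\<rbrakk> \<Longrightarrow> dist (f v) (f u) < e"
    using assms(2) unfolding uniformly_continuous_on_def by meson
  have "modulus_bound f (d/2) e"
    unfolding modulus_bound_def
  proof (intro ballI impI)
    fix u v :: "real^'n" assume "u \<in> unit_sphere" "v \<in> unit_sphere" "dist u v \<le> d/2"
    then show "\<bar>f u - f v\<bar> \<le> e" using d(2)[of v u] d(1) by (simp add: dist_real_def)
  qed
  then show ?thesis using that[of "d/2"] d(1) by simp
qed

lemma dominated_subset_radial_maps:
  fixes f :: "real^'n \<Rightarrow> real"
  assumes f: "continuous_on unit_sphere f"
  shows "dominated f M \<subseteq> radial_maps"
proof
  fix g assume g: "g \<in> dominated f M"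
  have "continuous_on unit_sphere g"
    unfolding continuous_on_iff
  proof (intro ballI allI impI)
    fix x :: "real^'n" and e :: real assume x: "x \<in> unit_sphere" and e: "0 < e"
    obtain r where r: "0 < r" "modulus_bound f r (e/2)"
      using modulus_bound_exists[OF f, of "e/2"] e by auto
    then have "modulus_bound g r (e/2)" using g by (auto simp: dominated_def)
    then have "\<bar>g x' - g x\<bar> \<le> e/2" if "x' \<in> unit_sphere" "dist x' x < r" for x'
      using x that by (auto simp: modulus_bound_def)
    then have "\<forall>x'\<in>unit_sphere. dist x' x < r \<longrightarrow> dist (g x') (g x) < e"
      using e by (fastforce simp: dist_real_def)
    with r(1) show "\<exists>d>0. \<forall>x'\<in>unit_sphere. dist x' x < d \<longrightarrow> dist (g x') (g x) < e" by blast
  qed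
  with g show "g \<in> radial_maps" by (simp add: radial_maps_def dominated_def)
qed

text \<open>If two pairs of numbers differ by at most \<open>e\<close> in each entry, so do their
  maxima and their minima. Hence the same pair \<open>(r, e)\<close> works, without loss.\<close>

lemma dominated_max_min:
  assumes "g \<in> dominated f M" "h \<in> dominated f M"
  shows "(\<lambda>t. max (g t) (h t)) \<in> dominated f M" "(\<lambda>t. min (g t) (h t)) \<in> dominated f M"
proof -
  have "modulus_bound (\<lambda>t. max (g t) (h t)) r e \<and> modulus_bound (\<lambda>t. min (g t) (h t)) r e"
    if "modulus_bound f r e" for r e
  proof -
    have "modulus_bound g r e" "modulus_bound h r e"
      using assms that by (auto simp: dominated_def)
    then show ?thesis by (fastforce simp: modulus_bound_def max_def min_def abs_le_iff)
  qed
  then show "(\<lambda>t. max (g t) (h t)) \<in> dominated f M" "(\<lambda>t. min (g t) (h t)) \<in> dominated f M"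
    using assms by (auto simp: dominated_def le_max_iff_disj min_le_iff_disj)
qed

lemma orthogonal_matrix_isometry:
  fixes A :: "real^'n^'n"
  assumes "orthogonal_matrix A"
  shows "norm (A *v x) = norm x" "dist (A *v x) (A *v y) = dist x y"
proof -
  have "orthogonal_transformation ((*v) A)"
    using assms by (simp add: orthogonal_transformation_matrix)
  then show "norm (A *v x) = norm x" "dist (A *v x) (A *v y) = dist x y"
    by (simp_all add: orthogonal_transformation_norm orthogonal_transformation_isometry)
qed

lemma dominated_rotate:
  assumes "g \<in> dominated f M" "orthogonal_matrix A"
  shows "(\<lambda>t. g (A *v t)) \<in> dominated f M"
  using assms(1) orthogonal_matrix_isometry[OF assms(2)]
  by (simp add: dominated_def modulus_bound_def)

text \<open>Arzela--Ascoli gives a uniformly convergent subsequence. All conditions defining the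
  family are non-strict pointwise inequalities, so the limit does not leave it.\<close>

lemma dominated_seq_compact:
  fixes G :: "nat \<Rightarrow> real^'n \<Rightarrow> real"
  assumes f: "continuous_on unit_sphere f" and G: "\<And>n. G n \<in> dominated f M"
  obtains g k where "g \<in> dominated f M" "strict_mono (k :: nat \<Rightarrow> nat)"
    "\<And>e. 0 < e \<Longrightarrow> \<exists>N. \<forall>n\<ge>N. \<forall>t\<in>unit_sphere. \<bar>G (k n) t - g t\<bar> < e"
proof -
  obtain g k where gk: "continuous_on unit_sphere g" "strict_mono (k :: nat \<Rightarrow> nat)"
    "\<And>e. 0 < e \<Longrightarrow> \<exists>N. \<forall>n x. n \<ge> N \<and> x \<in> unit_sphere \<longrightarrow> norm (G (k n) x - g x) < e"
  proof (rule Arzela_Ascoli[of "unit_sphere :: (real^'n) set" G M])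
    show "norm (G n x) \<le> M" if "x \<in> unit_sphere" for n x
      using G[of n] that by (simp add: dominated_def)
    fix x :: "real^'n" and e :: real assume x: "x \<in> unit_sphere" and e: "0 < e"
    obtain r where r: "0 < r" "modulus_bound f r (e/2)"
      using modulus_bound_exists[OF f, of "e/2"] e by auto
    \<comment> \<open>The radius \<open>r\<close> depends on \<open>f\<close> only, so one radius
      serves all \<open>n\<close>: this is equicontinuity.\<close>
    then have m: "modulus_bound (G n) r (e/2)" for n
      using G[of n] by (auto simp: dominated_def)
    have "\<bar>G n x - G n y\<bar> < e" if "y \<in> unit_sphere" "norm (x - y) < r" for n y
    proof -
      have "\<bar>G n x - G n y\<bar> \<le> e/2"
        using m[of n] x that by (auto simp: modulus_bound_def dist_norm)
      then show ?thesis using e by linarith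
    qed
    then show "\<exists>d. 0 < d \<and> (\<forall>n y. y \<in> unit_sphere \<and> norm (x - y) < d \<longrightarrow> norm (G n x - G n y) < e)"
      using r(1) by (intro exI[of _ r]) auto
  qed auto
  have lim: "(\<lambda>n. G (k n) t) \<longlonglongrightarrow> g t" if "t \<in> unit_sphere" for t
    using gk(3) that unfolding lim_sequentially dist_norm by blast
  have "g \<in> dominated f M"
    unfolding dominated_def
  proof (intro CollectI conjI ballI allI impI)
    fix t :: "real^'n" assume t: "t \<in> unit_sphere"
    show "0 \<le> g t" by (rule LIMSEQ_le_const[OF lim[OF t]]) (use G t in \<open>auto simp: dominated_def\<close>)
    show "g t \<le> M" by (rule LIMSEQ_le_const2[OF lim[OF t]]) (use G t in \<open>auto simp: dominated_def\<close>)
  next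
    fix r e assume f: "modulus_bound f r e"
    show "modulus_bound g r e" unfolding modulus_bound_def
    proof (intro ballI impI)
      fix u v :: "real^'n" assume uv: "u \<in> unit_sphere" "v \<in> unit_sphere" "dist u v \<le> r"
      have "(\<lambda>n. \<bar>G (k n) u - G (k n) v\<bar>) \<longlonglongrightarrow> \<bar>g u - g v\<bar>"
        by (intro tendsto_intros lim uv)
      moreover have "\<bar>G (k n) u - G (k n) v\<bar> \<le> e" for n
        using G[of "k n"] f uv by (auto simp: dominated_def modulus_bound_def)
      ultimately show "\<bar>g u - g v\<bar> \<le> e" by (intro LIMSEQ_le_const2) auto
    qed
  qed
  then show ?thesis using that gk(2,3) by (metis real_norm_def)
qed

lemma rotation_exists_matrix:
  fixes s t :: "real^'n"
  assumes "2 \<le> CARD('n)" "norm s = norm t"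
  obtains A where "rotation_matrix A" "A *v s = t"
proof -
  obtain \<phi> where \<phi>: "orthogonal_transformation \<phi>" "det (matrix \<phi>) = 1" "\<phi> s = t"
    using rotation_exists[OF assms] by blast
  then have "rotation_matrix (matrix \<phi>)" "matrix \<phi> *v s = t"
    by (auto simp: rotation_matrix_def orthogonal_transformation_matrix)
  then show ?thesis by (rule that)
qed

section \<open>The maximum argument\<close>

text \<open>Star bodies are replaced by their radial functions: union and intersection become
  maximum and minimum, the radial metric becomes uniform distance, and rotating a body becomes
  composition with a rotation. Assumption \<open>continuous\<close> also makes \<open>U f\<close>
  depend only on the values of \<open>f\<close> on the sphere.\<close>

locale invariant_functional =
  fixes U :: "(real^'n \<Rightarrow> real) \<Rightarrow> real"
  assumes modular: "\<lbrakk>f \<in> radial_maps; g \<in> radial_maps\<rbrakk> \<Longrightarrow>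
      U (\<lambda>t. max (f t) (g t)) + U (\<lambda>t. min (f t) (g t)) = U f + U g"
    and continuous: "\<lbrakk>f \<in> radial_maps; 0 < e\<rbrakk> \<Longrightarrow>
      \<exists>d>0. \<forall>g\<in>radial_maps. (\<forall>t\<in>unit_sphere. \<bar>f t - g t\<bar> < d) \<longrightarrow> \<bar>U g - U f\<bar> < e"
    and invariant: "\<lbrakk>f \<in> radial_maps; rotation_matrix A\<rbrakk> \<Longrightarrow> U (\<lambda>t. f (A *v t)) = U f"
    and card_ge_2: "2 \<le> CARD('n)"
begin

text \<open>A continuous functional on a sequentially compact family attains its maximum. No
  topology is put on the functions; compactness is shown for the image, a set of reals.\<close>

lemma attains_maximum_on_dominated:
  assumes f: "continuous_on unit_sphere f" and ne: "dominated f M \<noteq> {}"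
  obtains g where "g \<in> dominated f M" "\<And>h. h \<in> dominated f M \<Longrightarrow> U h \<le> U g"
proof -
  have "seq_compact (U ` dominated f M)"
    unfolding seq_compact_def
  proof (intro allI impI)
    fix X :: "nat \<Rightarrow> real" assume "\<forall>n. X n \<in> U ` dominated f M"
    then have "\<forall>n. \<exists>g. g \<in> dominated f M \<and> X n = U g" by blast
    then obtain G where G: "\<And>n. G n \<in> dominated f M" "\<And>n. X n = U (G n)" by metis
    obtain g k where gk: "g \<in> dominated f M" "strict_mono (k :: nat \<Rightarrow> nat)"
      "\<And>e. 0 < e \<Longrightarrow> \<exists>N. \<forall>n\<ge>N. \<forall>t\<in>unit_sphere. \<bar>G (k n) t - g t\<bar> < e"
      by (rule dominated_seq_compact[where G = G, OF f G(1)]) blast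
    have P: "h \<in> radial_maps" if "h \<in> dominated f M" for h
      using dominated_subset_radial_maps[OF f] that by blast
    have "(X \<circ> k) \<longlonglongrightarrow> U g"
      unfolding lim_sequentially dist_real_def
    proof (intro allI impI)
      fix e :: real assume "0 < e"
      then obtain d where d: "0 < d"
        "\<And>h. \<lbrakk>h \<in> radial_maps; \<forall>t\<in>unit_sphere. \<bar>g t - h t\<bar> < d\<rbrakk> \<Longrightarrow> \<bar>U h - U g\<bar> < e"
        using continuous[OF P[OF gk(1)]] by meson
      obtain N where N: "\<forall>n\<ge>N. \<forall>t\<in>unit_sphere. \<bar>G (k n) t - g t\<bar> < d"
        using gk(3)[OF d(1)] by blast
      have "\<bar>U (G (k n)) - U g\<bar> < e" if "N \<le> n" for n
        by (rule d(2)) (use N that P[OF G(1)] in \<open>auto simp: abs_minus_commute\<close>)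
      then show "\<exists>N. \<forall>n\<ge>N. \<bar>(X \<circ> k) n - U g\<bar> < e" by (auto simp: G(2))
    qed
    then show "\<exists>l\<in>U ` dominated f M. \<exists>r. strict_mono r \<and> (X \<circ> r) \<longlonglongrightarrow> l"
      using gk(1,2) by blast
  qed
  then have "compact (U ` dominated f M)" by (simp add: compact_eq_seq_compact_metric)
  from compact_attains_sup[OF this] ne show ?thesis using that by auto
qed

lemma nonpos_if_null_on_constants:
  assumes null: "\<And>c. 0 \<le> c \<Longrightarrow> U (\<lambda>t. c) = 0" and f: "f \<in> radial_maps"
  shows "U f \<le> 0"
proof -
  have cf: "continuous_on unit_sphere f" using f by (simp add: radial_maps_def)
  have "compact (f ` unit_sphere)" using cf by (intro compact_continuous_image) auto
  then obtain M where "\<And>t. t \<in> unit_sphere \<Longrightarrow> \<bar>f t\<bar> \<le> M"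
    using compact_imp_bounded bounded_iff by (metis imageI real_norm_def)
  then have fD: "f \<in> dominated f M"
    using f by (auto simp: dominated_def radial_maps_def abs_le_iff)
  obtain g where g: "g \<in> dominated f M" "\<And>h. h \<in> dominated f M \<Longrightarrow> U h \<le> U g"
    using attains_maximum_on_dominated[OF cf, of M] fD by blast
  have P: "h \<in> radial_maps" if "h \<in> dominated f M" for h
    using dominated_subset_radial_maps[OF cf] that by blast
  have cg: "continuous_on unit_sphere g" using P[OF g(1)] by (simp add: radial_maps_def)
  obtain b :: "real^'n" where b: "b \<in> unit_sphere"
    using norm_Basis nonempty_Basis by (metis ex_in_conv mem_sphere_0)
  then obtain t0 where t0: "t0 \<in> unit_sphere" "\<And>t. t \<in> unit_sphere \<Longrightarrow> g t \<le> g t0"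
    using continuous_attains_sup[OF _ _ cg] by auto
  define m where "m = g t0"
  have m0: "0 \<le> m" using g(1) t0(1) by (simp add: dominated_def m_def)
  \<comment> \<open>\<open>A s\<close> carries \<open>s\<close> to the peak \<open>t0\<close> of
    \<open>g\<close>, so the rotated copy \<open>g (A s *v t)\<close>, as a function of
    \<open>t\<close>, attains the value \<open>m\<close> at \<open>t = s\<close>.\<close>
  have "\<forall>s. \<exists>A. s \<in> unit_sphere \<longrightarrow> rotation_matrix A \<and> A *v s = t0"
    using rotation_exists_matrix[OF card_ge_2] t0(1) by (metis mem_sphere_0)
  then obtain A where A: "\<And>s. s \<in> unit_sphere \<Longrightarrow> rotation_matrix (A s) \<and> A s *v s = t0"
    by metis
  \<comment> \<open>Maximality forces equality in \<open>U (g \<or> h) + U (g \<and> h) = U g + U h\<close>,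
    so maximizers are closed under pointwise maximum.\<close>
  have join: "\<exists>h\<in>dominated f M. U h = U g \<and> (\<forall>t\<in>unit_sphere. h t \<le> m) \<and>
      (\<forall>t\<in>unit_sphere. \<forall>s\<in>C. g (A s *v t) \<le> h t)" if "finite C" "C \<subseteq> unit_sphere" for C
    using that
  proof (induction C rule: finite_induct)
    case empty
    then show ?case using g(1) t0(2) by (auto simp: m_def)
  next
    case (insert s C)
    then obtain h where h: "h \<in> dominated f M" "U h = U g" "\<forall>t\<in>unit_sphere. h t \<le> m"
      "\<forall>t\<in>unit_sphere. \<forall>s\<in>C. g (A s *v t) \<le> h t" by blast
    have As: "rotation_matrix (A s)" "orthogonal_matrix (A s)"
      using A insert.prems by (auto simp: rotation_matrix_def)
    let ?k = "\<lambda>t. g (A s *v t)"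
    have k: "?k \<in> dominated f M" "U ?k = U g"
      using dominated_rotate[OF g(1) As(2)] invariant[OF P[OF g(1)] As(1)] by auto
    have "U (\<lambda>t. max (h t) (?k t)) + U (\<lambda>t. min (h t) (?k t)) = U g + U g"
      using modular[OF P[OF h(1)] P[OF k(1)]] h(2) k(2) by simp
    moreover note g(2)[OF dominated_max_min(1)[OF h(1) k(1)]] g(2)[OF dominated_max_min(2)[OF h(1) k(1)]]
    ultimately have "U (\<lambda>t. max (h t) (?k t)) = U g" by linarith
    moreover have "\<forall>t\<in>unit_sphere. ?k t \<le> m"
      using t0(2) orthogonal_matrix_isometry(1)[OF As(2)] by (simp add: m_def)
    ultimately show ?case
      using dominated_max_min(1)[OF h(1) k(1)] h(3,4)
      by (intro bexI[of _ "\<lambda>t. max (h t) (?k t)"]) (auto simp: le_max_iff_disj)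
  qed
  have "U g \<le> e" if "0 < e" for e
  proof -
    have "(\<lambda>t. m) \<in> radial_maps" using m0 by (simp add: radial_maps_def)
    note continuous[OF this \<open>0 < e\<close>]
    then obtain d where d: "0 < d"
      "\<And>h. \<lbrakk>h \<in> radial_maps; \<forall>t\<in>unit_sphere. \<bar>m - h t\<bar> < d\<rbrakk> \<Longrightarrow> \<bar>U h - U (\<lambda>t. m)\<bar> < e"
      by meson
    \<comment> \<open>Within distance \<open>r\<close> of \<open>t0\<close>, \<open>g\<close> stays
      within \<open>d/2\<close> of its maximum \<open>m\<close>. The copy belonging to
      \<open>s\<close> does the same near \<open>s\<close>, so finitely many centres whose
      \<open>r\<close>-balls cover the sphere suffice.\<close>
    obtain r where r: "0 < r" "modulus_bound g r (d/2)"
      using modulus_bound_exists[OF cg, of "d/2"] d(1) by auto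
    have cover: "unit_sphere \<subseteq> (\<Union>s\<in>unit_sphere. ball (s::real^'n) r)" using r(1) by force
    obtain C :: "(real^'n) set" where C: "finite C" "C \<subseteq> unit_sphere" "unit_sphere \<subseteq> (\<Union>s\<in>C. ball s r)"
      by (rule compactE_image[OF compact_sphere _ cover]) (simp, blast)
    obtain h where h: "h \<in> dominated f M" "U h = U g" "\<forall>t\<in>unit_sphere. h t \<le> m"
      "\<forall>t\<in>unit_sphere. \<forall>s\<in>C. g (A s *v t) \<le> h t" using join[OF C(1,2)] by blast
    \<comment> \<open>A rotated copy with centre near \<open>t\<close> bounds \<open>h t\<close>
      below by \<open>m - d/2\<close>, and \<open>join\<close> bounds it above by
      \<open>m\<close>.\<close>
    have "\<bar>m - h t\<bar> < d" if t: "t \<in> unit_sphere" for t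
    proof -
      obtain s where s: "s \<in> C" "dist s t < r" using C(3) t by auto
      then have As: "rotation_matrix (A s)" "A s *v s = t0" using A C(2) by auto
      then have o: "orthogonal_matrix (A s)" by (simp add: rotation_matrix_def)
      have "dist t0 (A s *v t) = dist s t"
        using orthogonal_matrix_isometry(2)[OF o, of s t] As(2) by simp
      moreover have "A s *v t \<in> unit_sphere"
        using t orthogonal_matrix_isometry(1)[OF o] by simp
      ultimately have "\<bar>m - g (A s *v t)\<bar> \<le> d/2"
        using r(2) t0(1) s(2) by (auto simp: modulus_bound_def m_def)
      moreover have "g (A s *v t) \<le> h t" "h t \<le> m" using h(3,4) t s(1) by auto
      ultimately show ?thesis using d(1) by linarith
    qed
    then have "\<bar>U h - U (\<lambda>t. m)\<bar> < e" using d(2)[OF P[OF h(1)]] by blast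
    then show "U g \<le> e" using h(2) null[OF m0] by linarith
  qed
  then have "U g \<le> 0" by (metis field_le_epsilon add_0)
  then show ?thesis using g(2)[OF fD] by linarith
qed

text \<open>The locale assumptions are stable under passing from \<open>U\<close> to
  \<open>- U\<close>, so the one-sided bound holds for both.\<close>

lemma eq_0_if_null_on_constants:
  assumes null: "\<And>c. 0 \<le> c \<Longrightarrow> U (\<lambda>t. c) = 0" and f: "f \<in> radial_maps"
  shows "U f = 0"
proof -
  interpret neg: invariant_functional "\<lambda>f. - U f"
  proof
    show "2 \<le> CARD('n)" by (rule card_ge_2)
    show "- U (\<lambda>t. max (f t) (g t)) + - U (\<lambda>t. min (f t) (g t)) = - U f + - U g"
      if "f \<in> radial_maps" "g \<in> radial_maps" for f g
      using modular[OF that] by linarith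
    show "\<exists>d>0. \<forall>g\<in>radial_maps. (\<forall>t\<in>unit_sphere. \<bar>f t - g t\<bar> < d) \<longrightarrow> \<bar>- U g - - U f\<bar> < e"
      if "f \<in> radial_maps" "0 < e" for f e
      using continuous[OF that] by (simp add: abs_minus_commute)
  qed (simp add: invariant)
  have "U f \<le> 0" by (rule nonpos_if_null_on_constants[OF null f])
  moreover have "- U f \<le> 0" by (rule neg.nonpos_if_null_on_constants[OF _ f]) (simp add: null)
  ultimately show ?thesis by linarith
qed

end

section \<open>The surface measure of the sphere\<close>

text \<open>Orthogonal maps send balls to balls of the same radius, and the volume of a ball does
  not depend on its centre. Balls control open sets by a covering argument, and open sets generate
  the Borel sets.\<close>

lemma lborel_orthogonal_transformation:
  fixes T :: "'a::euclidean_space \<Rightarrow> 'a"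
  assumes T: "orthogonal_transformation T"
  shows "distr lborel borel T = lborel"
proof -
  have cont: "continuous_on UNIV T" if "orthogonal_transformation T" for T :: "'a \<Rightarrow> 'a"
    using orthogonal_transformation_linear[OF that]
    by (intro linear_continuous_on) (simp add: linear_conv_bounded_linear)
  have meas: "T \<in> borel_measurable borel" if "orthogonal_transformation T" for T :: "'a \<Rightarrow> 'a"
    using cont[OF that] by (rule borel_measurable_continuous_onI)
  have ball: "emeasure (distr lborel borel T) (ball a r) = emeasure lborel (ball a r)"
    if T: "orthogonal_transformation T" for T :: "'a \<Rightarrow> 'a" and a r
  proof -
    have "T -` ball a r = inv T ` ball a r"
      using orthogonal_transformation_bij[OF T] by (rule bij_vimage_eq_inv_image)
    also have "\<dots> = ball (inv T a) r"
      by (rule image_orthogonal_transformation_ball[OF orthogonal_transformation_inv[OF T]])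
    finally have "emeasure (distr lborel borel T) (ball a r) = emeasure lborel (ball (inv T a) r)"
      using meas[OF T] by (simp add: emeasure_distr)
    also have "\<dots> = emeasure lborel (ball a r)"
      by (cases "0 \<le> r") (simp_all add: emeasure_ball ball_empty)
    finally show ?thesis .
  qed
  \<comment> \<open>By Vitali's theorem an open set is, up to a null set, a disjoint union of balls.\<close>
  have le: "emeasure lborel G \<le> emeasure (distr lborel borel T) G"
    if T: "orthogonal_transformation T" and G: "open G" for T :: "'a \<Rightarrow> 'a" and G
  proof -
    let ?K = "{(a, r). ball a r \<subseteq> G}"
    obtain C where C: "countable C" "C \<subseteq> ?K"
      "pairwise (\<lambda>i j. disjnt (ball (fst i) (snd i)) (ball (fst j) (snd j))) C"
      "negligible (G - (\<Union>i\<in>C. ball (fst i) (snd i)))"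
    proof (rule Vitali_covering_theorem_balls[of G ?K fst snd])
      fix x and d :: real assume "x \<in> G" "0 < d"
      then obtain e where e: "0 < e" "ball x e \<subseteq> G" using G open_contains_ball by blast
      \<comment> \<open>Vitali's theorem asks for arbitrarily small balls around each point:
        \<open>e\<close> keeps the ball inside \<open>G\<close>, and \<open>d/2\<close> keeps the
        radius strictly below \<open>d\<close>.\<close>
      have "ball x (min e (d/2)) \<subseteq> G" using e(2) by auto
      then show "\<exists>i. i \<in> ?K \<and> x \<in> ball (fst i) (snd i) \<and> snd i < d"
        using e(1) \<open>0 < d\<close> by (intro exI[of _ "(x, min e (d/2))"]) auto
    qed
    let ?U = "\<Union>i\<in>C. ball (fst i) (snd i)"
    have U: "?U \<in> sets borel" by (intro borel_open open_UN) simp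
    have UG: "?U \<subseteq> G" using C(2) by fastforce
    have dis: "disjoint_family_on (\<lambda>i. ball (fst i) (snd i)) C"
      using C(3) by (auto simp: disjoint_family_on_def pairwise_def disjnt_def)
    have "G - ?U \<in> null_sets lebesgue" using C(4) by (simp add: negligible_iff_null_sets)
    moreover have "G - ?U \<in> sets borel" using G U by auto
    ultimately have "emeasure lborel (G - ?U) = 0"
      by (simp add: null_sets_def)
    then have "emeasure lborel G = emeasure lborel ?U"
      using U UG G emeasure_Un_null_set[of ?U lborel "G - ?U"]
      by (simp add: null_sets_def Un_absorb1)
    also have "\<dots> = (\<integral>\<^sup>+i. emeasure lborel (ball (fst i) (snd i)) \<partial>count_space C)"
      by (intro emeasure_UN_countable C(1) dis) simp
    also have "\<dots> = (\<integral>\<^sup>+i. emeasure (distr lborel borel T) (ball (fst i) (snd i)) \<partial>count_space C)"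
      by (simp add: ball[OF T])
    also have "\<dots> = emeasure (distr lborel borel T) ?U"
      by (intro emeasure_UN_countable[symmetric] C(1) dis) simp
    also have "\<dots> \<le> emeasure (distr lborel borel T) G"
      using UG G by (intro emeasure_mono) auto
    finally show ?thesis .
  qed
  \<comment> \<open>The reverse inequality is \<open>le\<close> for the inverse transformation,
    applied to the preimage of \<open>G\<close>.\<close>
  have eq: "emeasure (distr lborel borel T) G = emeasure lborel G" if G: "open G" for G
  proof (rule antisym)
    let ?H = "T -` G"
    have H: "open ?H"
      using G cont[OF T] by (rule open_vimage)
    have "emeasure (distr lborel borel T) G = emeasure lborel ?H"
      using meas[OF T] G by (simp add: emeasure_distr)
    also have "\<dots> \<le> emeasure (distr lborel borel (inv T)) ?H"
      by (rule le[OF orthogonal_transformation_inv[OF T] H])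
    also have "\<dots> = emeasure lborel (inv T -` ?H)"
      using meas[OF orthogonal_transformation_inv[OF T]] H by (simp add: emeasure_distr)
    also have "inv T -` ?H = G"
      using orthogonal_transformation_surj[OF T] by (auto simp: surj_f_inv_f)
    finally show "emeasure (distr lborel borel T) G \<le> emeasure lborel G" .
  qed (rule le[OF T G])
  \<comment> \<open>Uniqueness of measures: open sets form an intersection-stable generator, and the
    balls of radius \<open>n\<close> exhaust the space with finite measure.\<close>
  show ?thesis
  proof (rule measure_eqI_generator_eq[where \<Omega> = UNIV and E = "{G. open G}" and A = "\<lambda>n. ball 0 (real n)"])
    show "(\<Union>n. ball (0::'a) (real n)) = UNIV"
      using reals_Archimedean2 by auto
    show "emeasure (distr lborel borel T) (ball 0 (real n)) \<noteq> \<infinity>" for n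
      by (simp add: ball[OF T] emeasure_ball)
    show "sets (distr lborel borel T) = sigma_sets UNIV {G. open G}"
      "sets (lborel :: 'a measure) = sigma_sets UNIV {G. open G}"
      by (simp_all add: sets_borel)
  qed (auto simp: Int_stable_def eq)
qed

section \<open>Rotation invariance of the normalized surface measure\<close>

lemma space_normalized_surface_measure: "space (normalized_surface_measure :: (real^'n) measure) = unit_sphere"
  and sets_normalized_surface_measure:
    "sets (normalized_surface_measure :: (real^'n) measure) = sets (restrict_space borel unit_sphere)"
  by (simp_all add: normalized_surface_measure_def space_surface_measure sets_surface_measure)

interpretation normalized_surface: prob_space "normalized_surface_measure :: (real^'n) measure"
  by (rule prob_spaceI)
     (simp add: space_normalized_surface_measure emeasure_normalized_surface_measure)

text \<open>A linear map commutes with scaling, so the cone over the preimage of \<open>E\<close> is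
  the preimage of the cone over \<open>E\<close>. Invariance therefore descends from Lebesgue
  measure through the cone formula.\<close>

lemma normalized_surface_measure_orthogonal:
  fixes A :: "real^'n^'n"
  assumes A: "orthogonal_matrix A"
  shows "(*v) A \<in> measurable normalized_surface_measure normalized_surface_measure"
    and "distr normalized_surface_measure normalized_surface_measure ((*v) A)
      = normalized_surface_measure"
proof -
  have T: "orthogonal_transformation ((*v) A)"
    using A by (simp add: orthogonal_transformation_matrix)
  have mA: "(*v) A \<in> borel_measurable borel"
    by (intro borel_measurable_continuous_onI linear_continuous_on) simp
  then have mr: "(*v) A \<in> measurable (restrict_space borel unit_sphere) (restrict_space borel unit_sphere)"
    using orthogonal_matrix_isometry(1)[OF A]
    by (intro measurable_restrict_space3) auto
  then show m: "(*v) A \<in> measurable normalized_surface_measure normalized_surface_measure"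
    using measurable_cong_sets[OF sets_normalized_surface_measure sets_normalized_surface_measure]
    by blast
  have surf: "emeasure surface_measure ((*v) A -` E \<inter> unit_sphere) = emeasure surface_measure E"
    if E: "E \<in> sets (restrict_space borel unit_sphere)" for E
  proof -
    let ?cone = "\<lambda>E. {r *\<^sub>R t | r t. 0 < r \<and> r \<le> 1 \<and> t \<in> E}"
    have Eb: "E \<in> sets borel" "E \<subseteq> unit_sphere" using E by (auto simp: sets_restrict_space)
    have E'b: "(*v) A -` E \<inter> unit_sphere \<in> sets borel"
      using measurable_sets[OF mA Eb(1)] by auto
    \<comment> \<open>As a preimage under radial projection the cone is visibly Borel.\<close>
    have c: "?cone E = (\<lambda>x. x /\<^sub>R norm x) -` E \<inter> (cball 0 1 - {0})"
    proof (intro equalityI subsetI)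
      fix x assume x: "x \<in> (\<lambda>x. x /\<^sub>R norm x) -` E \<inter> (cball 0 1 - {0})"
      then have "x = norm x *\<^sub>R (x /\<^sub>R norm x)" "0 < norm x" "norm x \<le> 1" "x /\<^sub>R norm x \<in> E"
        by auto
      then show "x \<in> ?cone E" by blast
    next
      fix x assume "x \<in> ?cone E"
      then obtain r t where x: "x = r *\<^sub>R t" "0 < r" "r \<le> 1" "t \<in> E" by blast
      then have "norm t = 1" using Eb by auto
      with x show "x \<in> (\<lambda>x. x /\<^sub>R norm x) -` E \<inter> (cball 0 1 - {0})" by auto
    qed
    have "(\<lambda>x::real^'n. x /\<^sub>R norm x) \<in> borel_measurable borel" by measurable
    from measurable_sets[OF this Eb(1)] have cb: "?cone E \<in> sets borel" unfolding c by simp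
    have "?cone ((*v) A -` E \<inter> unit_sphere) = (*v) A -` ?cone E"
    proof (intro equalityI subsetI)
      fix x assume "x \<in> ?cone ((*v) A -` E \<inter> unit_sphere)"
      then obtain r t where "x = r *\<^sub>R t" "0 < r" "r \<le> 1" "A *v t \<in> E" by blast
      then show "x \<in> (*v) A -` ?cone E"
        by (auto simp: matrix_vector_mult_scaleR intro!: exI[of _ r] exI[of _ "A *v t"])
    next
      fix x assume "x \<in> (*v) A -` ?cone E"
      then obtain r t where x: "A *v x = r *\<^sub>R t" "0 < r" "r \<le> 1" "t \<in> E" by blast
      have "A *v (x /\<^sub>R r) = t" using x by (simp add: matrix_vector_mult_scaleR)
      then have "x /\<^sub>R r \<in> (*v) A -` E \<inter> unit_sphere"
        using x(4) Eb(2) orthogonal_matrix_isometry(1)[OF A, of "x /\<^sub>R r"] by auto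
      moreover have "x = r *\<^sub>R (x /\<^sub>R r)" using x(2) by simp
      ultimately show "x \<in> ?cone ((*v) A -` E \<inter> unit_sphere)" using x(2,3) by blast
    qed
    then have "emeasure lborel (?cone ((*v) A -` E \<inter> unit_sphere)) = emeasure (distr lborel borel ((*v) A)) (?cone E)"
      using mA cb by (simp add: emeasure_distr)
    also have "\<dots> = emeasure lborel (?cone E)"
      by (simp add: lborel_orthogonal_transformation[OF T])
    finally show ?thesis
      using emeasure_surface_measure[OF Eb] emeasure_surface_measure[OF E'b] by simp
  qed
  show "distr normalized_surface_measure normalized_surface_measure ((*v) A)
      = normalized_surface_measure"
  proof (rule measure_eqI)
    fix E assume "E \<in> sets (distr normalized_surface_measure normalized_surface_measure ((*v) A))"
    then have E: "E \<in> sets (restrict_space borel unit_sphere)"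
      by (simp add: sets_normalized_surface_measure)
    have E': "(*v) A -` E \<inter> unit_sphere \<in> sets (restrict_space borel unit_sphere)"
      using measurable_sets[OF mr E] by (simp add: space_restrict_space)
    have S: "unit_sphere \<in> sets (surface_measure :: (real^'n) measure)"
      using sets.top[of "surface_measure :: (real^'n) measure"] by (simp add: space_surface_measure)
    \<comment> \<open>A uniform measure intersects each set with its base set, here the whole
      sphere; these identities remove that intersection.\<close>
    have sub: "unit_sphere \<inter> E = E" "unit_sphere \<inter> ((*v) A -` E \<inter> unit_sphere) = (*v) A -` E \<inter> unit_sphere"
      using E by (auto simp: sets_restrict_space)
    show "emeasure (distr normalized_surface_measure normalized_surface_measure ((*v) A)) E
        = emeasure normalized_surface_measure E"
      using E E' S surf[OF E] m unfolding normalized_surface_measure_def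
      by (simp add: emeasure_distr sets_surface_measure space_surface_measure sub
        sets_normalized_surface_measure emeasure_uniform_measure)
  qed simp
qed

lemma borel_measurable_sphere:
  fixes h :: "real^'n \<Rightarrow> real"
  assumes "continuous_on unit_sphere h"
  shows "h \<in> borel_measurable normalized_surface_measure"
  using borel_measurable_continuous_on_restrict[OF assms]
    measurable_cong_sets[OF sets_normalized_surface_measure refl] by blast

lemma integrable_sphere:
  fixes h :: "real^'n \<Rightarrow> real"
  assumes h: "continuous_on unit_sphere h"
  shows "integrable normalized_surface_measure h"
proof -
  have "compact (h ` unit_sphere)" using h by (intro compact_continuous_image) auto
  then obtain B where "\<And>t. t \<in> unit_sphere \<Longrightarrow> \<bar>h t\<bar> \<le> B"
    using compact_imp_bounded bounded_iff by (metis imageI real_norm_def)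
  then show ?thesis
    using borel_measurable_sphere[OF h]
    by (intro normalized_surface.integrable_const_bound[of _ B])
       (auto simp: space_normalized_surface_measure)
qed

lemma integral_sphere_orthogonal:
  fixes A :: "real^'n^'n" and h :: "real^'n \<Rightarrow> real"
  assumes A: "orthogonal_matrix A" and h: "continuous_on unit_sphere h"
  shows "(\<integral>t. h (A *v t) \<partial>normalized_surface_measure) = (\<integral>t. h t \<partial>normalized_surface_measure)"
  using integral_distr[OF normalized_surface_measure_orthogonal(1)[OF A] borel_measurable_sphere[OF h]]
  by (simp add: normalized_surface_measure_orthogonal(2)[OF A])

section \<open>Star bodies and their radial functions\<close>

text \<open>Inverse to \<open>radial_function\<close> between star bodies and
  \<open>radial_maps\<close>, up to values off the sphere.\<close>

definition body_of :: "(real^'n \<Rightarrow> real) \<Rightarrow> (real^'n) set" where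
  "body_of f = {c *\<^sub>R t | c t. t \<in> unit_sphere \<and> 0 \<le> c \<and> c \<le> f t}"

lemma radial_function_in_radial_maps:
  "K \<in> star_bodies \<Longrightarrow> radial_function K \<in> radial_maps"
  using star_set_ray(2) by (auto simp: star_bodies_def radial_maps_def)

lemma radial_function_body_of:
  assumes "f \<in> radial_maps" "t \<in> unit_sphere"
  shows "radial_function (body_of f) t = f t"
  unfolding body_of_def using assms by (intro star_set_of_radial(2)) (auto simp: radial_maps_def)

lemma body_of_in_star_bodies:
  assumes f: "f \<in> radial_maps"
  shows "body_of f \<in> star_bodies"
proof -
  have "star_set (body_of f)"
    unfolding body_of_def using f by (intro star_set_of_radial(1)) (auto simp: radial_maps_def)
  moreover have "continuous_on unit_sphere (radial_function (body_of f))"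
  proof (rule iffD2[OF continuous_on_cong[OF refl radial_function_body_of[OF f]]])
    show "continuous_on unit_sphere f" using f by (simp add: radial_maps_def)
  qed
  ultimately show ?thesis by (simp add: star_bodies_def)
qed

lemma body_of_radial_function:
  "K \<in> star_bodies \<Longrightarrow> body_of (radial_function K) = K"
  using star_set_eq[of K] by (simp add: body_of_def star_bodies_def)

lemma max_min_in_radial_maps:
  assumes "f \<in> radial_maps" "g \<in> radial_maps"
  shows "(\<lambda>t. max (f t) (g t)) \<in> radial_maps" "(\<lambda>t. min (f t) (g t)) \<in> radial_maps"
  using assms by (auto simp: radial_maps_def intro!: continuous_intros)

lemma rotate_in_radial_maps:
  fixes A :: "real^'n^'n"
  assumes "f \<in> radial_maps" "orthogonal_matrix A"
  shows "(\<lambda>t. f (A *v t)) \<in> radial_maps"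
proof -
  have "continuous_on unit_sphere (\<lambda>t. f (A *v t))"
  proof (rule continuous_on_compose2[of unit_sphere f])
    show "continuous_on unit_sphere ((*v) A)" by (intro linear_continuous_on) simp
  qed (use assms orthogonal_matrix_isometry(1)[OF assms(2)] in \<open>auto simp: radial_maps_def\<close>)
  then show ?thesis
    using assms(1) orthogonal_matrix_isometry(1)[OF assms(2)] by (simp add: radial_maps_def)
qed

lemma body_of_Un: "body_of f \<union> body_of g = body_of (\<lambda>t. max (f t) (g t))"
  unfolding body_of_def by (auto simp: le_max_iff_disj)

text \<open>A point of the intersection comes with one polar representation for \<open>f\<close> and
  one for \<open>g\<close>, and at the origin the two directions may differ. The ray description of
  \<open>body_of g\<close> lets the representation chosen for \<open>f\<close> serve for
  \<open>g\<close> too.\<close>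

lemma body_of_Int:
  assumes "f \<in> radial_maps" "g \<in> radial_maps"
  shows "body_of f \<inter> body_of g = body_of (\<lambda>t. min (f t) (g t))"
proof (intro equalityI subsetI)
  fix x assume x: "x \<in> body_of f \<inter> body_of g"
  then obtain c t where ct: "x = c *\<^sub>R t" "t \<in> unit_sphere" "0 \<le> c" "c \<le> f t"
    by (auto simp: body_of_def)
  have "star_set (body_of g)" using body_of_in_star_bodies[OF assms(2)] by (simp add: star_bodies_def)
  from star_set_ray(1)[OF this ct(2)] have "c \<le> g t"
    using x ct radial_function_body_of[OF assms(2) ct(2)] by auto
  then show "x \<in> body_of (\<lambda>t. min (f t) (g t))" using ct by (auto simp: body_of_def)
qed (auto simp: body_of_def)

text \<open>The transpose is the inverse: the rotated body reaches in direction \<open>t\<close> as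
  far as the original does in the direction that \<open>A\<close> sends to \<open>t\<close>.\<close>

lemma body_of_rotate:
  fixes A :: "real^'n^'n"
  assumes A: "orthogonal_matrix A"
  shows "(*v) A ` body_of f = body_of (\<lambda>t. f (transpose A *v t))"
proof -
  have inv: "transpose A *v (A *v x) = x" "A *v (transpose A *v x) = x" for x
    using A unfolding orthogonal_matrix_def by (metis matrix_vector_mul_assoc matrix_vector_mul_lid)+
  have A': "orthogonal_matrix (transpose A)" using A by simp
  show ?thesis
  proof (intro equalityI subsetI)
    fix x assume "x \<in> (*v) A ` body_of f"
    then obtain c t where "x = c *\<^sub>R (A *v t)" "t \<in> unit_sphere" "0 \<le> c" "c \<le> f t"
      by (auto simp: body_of_def matrix_vector_mult_scaleR)
    then show "x \<in> body_of (\<lambda>t. f (transpose A *v t))"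
      using orthogonal_matrix_isometry(1)[OF A] unfolding body_of_def
      by (intro CollectI exI[of _ c] exI[of _ "A *v t"]) (simp add: inv del: transpose_matrix_vector)
  next
    fix x assume "x \<in> body_of (\<lambda>t. f (transpose A *v t))"
    then obtain c t where ct: "x = c *\<^sub>R t" "t \<in> unit_sphere" "0 \<le> c" "c \<le> f (transpose A *v t)"
      by (auto simp: body_of_def)
    then have "c *\<^sub>R (transpose A *v t) \<in> body_of f"
      using orthogonal_matrix_isometry(1)[OF A'] unfolding body_of_def by fastforce
    moreover have "x = A *v (c *\<^sub>R (transpose A *v t))"
      using ct(1) by (simp add: matrix_vector_mult_scaleR inv del: transpose_matrix_vector)
    ultimately show "x \<in> (*v) A ` body_of f" by blast
  qed
qed

lemma rotation_matrix_transpose: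
  fixes A :: "real^'n^'n"
  shows "rotation_matrix A \<Longrightarrow> rotation_matrix (transpose A)"
  by (simp add: rotation_matrix_def)

text \<open>The radial metric is a supremum by \<open>radial_dist_eq_Sup\<close>; compactness of the
  sphere bounds the differences, so this real supremum dominates each of them.\<close>

lemma radial_dist_less_imp:
  assumes K: "K \<in> star_bodies" and L: "L \<in> star_bodies" and d: "radial_dist K L < d"
    and t: "t \<in> unit_sphere"
  shows "\<bar>radial_function K t - radial_function L t\<bar> < d"
proof -
  let ?d = "\<lambda>t. \<bar>radial_function K t - radial_function L t\<bar>"
  have "continuous_on unit_sphere ?d"
    using K L by (intro continuous_intros) (auto simp: star_bodies_def)
  then have "bdd_above (?d ` unit_sphere)"
    by (intro bounded_imp_bdd_above compact_imp_bounded compact_continuous_image) auto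
  from cSUP_upper[OF t this] d show ?thesis
    unfolding radial_dist_eq_Sup[OF K L] by linarith
qed

lemma radial_dist_le:
  fixes K L :: "(real^'n) set"
  assumes "K \<in> star_bodies" "L \<in> star_bodies"
    and le: "\<And>t. t \<in> unit_sphere \<Longrightarrow> \<bar>radial_function K t - radial_function L t\<bar> \<le> d"
  shows "radial_dist K L \<le> d"
proof -
  obtain b :: "real^'n" where "b \<in> unit_sphere"
    using norm_Basis nonempty_Basis by (metis ex_in_conv mem_sphere_0)
  then show ?thesis
    unfolding radial_dist_eq_Sup[OF assms(1,2)] using le by (intro cSUP_least) auto
qed

lemma continuous_on_compose_radial:
  assumes "continuous_on {0..} \<theta>" "f \<in> radial_maps"
  shows "continuous_on unit_sphere (\<lambda>t. \<theta> (f t) :: real)"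
  by (rule continuous_on_compose2[OF assms(1)]) (use assms(2) in \<open>auto simp: radial_maps_def\<close>)

section \<open>Integral valuations\<close>

definition integral_functional :: "(real \<Rightarrow> real) \<Rightarrow> (real^'n \<Rightarrow> real) \<Rightarrow> real" where
  "integral_functional \<theta> f = (\<integral>t. \<theta> (f t) \<partial>normalized_surface_measure)"

lemma integral_functional_cong:
  "(\<And>t. t \<in> unit_sphere \<Longrightarrow> f t = g t) \<Longrightarrow> integral_functional \<theta> f = integral_functional \<theta> g"
  unfolding integral_functional_def
  by (intro Bochner_Integration.integral_cong) (auto simp: space_normalized_surface_measure)

text \<open>The total mass is one. This is why \<open>\<theta>\<close> can be read off from the
  values of \<open>V\<close> on balls.\<close>

lemma integral_functional_const:
  "integral_functional \<theta> (\<lambda>t :: real^'n. c) = \<theta> c"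
  using normalized_surface.prob_space[where 'n = 'n] by (simp add: integral_functional_def)

text \<open>Maximum and minimum of two numbers are these numbers in some order, so the identity
  already holds for the integrands.\<close>

lemma integral_functional_modular:
  assumes \<theta>: "continuous_on {0..} \<theta>" and f: "f \<in> radial_maps" and g: "g \<in> radial_maps"
  shows "integral_functional \<theta> (\<lambda>t. max (f t) (g t)) + integral_functional \<theta> (\<lambda>t. min (f t) (g t))
    = integral_functional \<theta> f + integral_functional \<theta> g"
proof -
  note int = integrable_sphere[OF continuous_on_compose_radial[OF \<theta>]]
  have "\<theta> (max a b) + \<theta> (min a b) = \<theta> a + \<theta> b" for a b :: real
    by (simp add: max_def min_def)
  then show ?thesis
    unfolding integral_functional_def
    using int[OF f] int[OF g] int[OF max_min_in_radial_maps(1)[OF f g]]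
      int[OF max_min_in_radial_maps(2)[OF f g]]
    by (simp flip: Bochner_Integration.integral_add)
qed

lemma integral_functional_invariant:
  assumes "continuous_on {0..} \<theta>" "f \<in> radial_maps" "orthogonal_matrix A"
  shows "integral_functional \<theta> (\<lambda>t. f (A *v t)) = integral_functional \<theta> f"
  unfolding integral_functional_def
  by (rule integral_sphere_orthogonal[OF assms(3) continuous_on_compose_radial[OF assms(1,2)]])

lemma integral_functional_continuous:
  fixes f :: "real^'n \<Rightarrow> real"
  assumes \<theta>: "continuous_on {0..} \<theta>" and f: "f \<in> radial_maps" and e: "0 < e"
  shows "\<exists>d>0. \<forall>g\<in>radial_maps. (\<forall>t\<in>unit_sphere. \<bar>f t - g t\<bar> < d) \<longrightarrow>
    \<bar>integral_functional \<theta> g - integral_functional \<theta> f\<bar> < e"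
proof -
  have "compact (f ` unit_sphere)"
    using f by (intro compact_continuous_image) (auto simp: radial_maps_def)
  then obtain M where M: "\<And>t. t \<in> unit_sphere \<Longrightarrow> \<bar>f t\<bar> \<le> M"
    using compact_imp_bounded bounded_iff by (metis imageI real_norm_def)
  \<comment> \<open>\<open>\<theta>\<close> need not be uniformly continuous on the whole half-line.
    The extra 1 leaves room for the values of \<open>g\<close>, since the chosen distance is at most
    1.\<close>
  have "continuous_on {0..M+1} \<theta>" by (rule continuous_on_subset[OF \<theta>]) auto
  then have "uniformly_continuous_on {0..M+1} \<theta>" by (simp add: compact_uniformly_continuous)
  then obtain r where r: "0 < r"
    "\<And>a b. \<lbrakk>a \<in> {0..M+1}; b \<in> {0..M+1}; dist b a < r\<rbrakk> \<Longrightarrow> dist (\<theta> b) (\<theta> a) < e/2"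
    using e unfolding uniformly_continuous_on_def by (meson half_gt_zero)
  note int = integrable_sphere[OF continuous_on_compose_radial[OF \<theta>]]
  show ?thesis
  proof (intro exI[of _ "min r 1"] conjI ballI impI)
    fix g assume g: "g \<in> radial_maps" and fg: "\<forall>t\<in>unit_sphere. \<bar>f t - g t\<bar> < min r 1"
    have *: "\<bar>\<theta> (g t) - \<theta> (f t)\<bar> \<le> e/2" if t: "t \<in> unit_sphere" for t
    proof -
      have "f t \<in> {0..M+1}" "g t \<in> {0..M+1}" "dist (g t) (f t) < r"
        using f g t M[OF t] fg[rule_format, OF t] by (auto simp: radial_maps_def dist_real_def)
      then show ?thesis using r(2) by (force simp: dist_real_def)
    qed
    have "\<bar>integral_functional \<theta> g - integral_functional \<theta> f\<bar>
        = \<bar>\<integral>t. \<theta> (g t) - \<theta> (f t) \<partial>normalized_surface_measure\<bar>"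
      unfolding integral_functional_def using int[OF f] int[OF g] by simp
    also have "\<dots> \<le> (\<integral>t. \<bar>\<theta> (g t) - \<theta> (f t)\<bar> \<partial>normalized_surface_measure)"
      by (rule integral_abs_bound)
    \<comment> \<open>A pointwise bound passes to the mean over a probability space, but
      non-strictly; hence the halved \<open>e\<close>.\<close>
    also have "\<dots> \<le> e/2"
      by (rule normalized_surface.integral_le_const)
         (use int[OF f] int[OF g] * in \<open>auto simp: space_normalized_surface_measure\<close>)
    finally show "\<bar>integral_functional \<theta> g - integral_functional \<theta> f\<bar> < e" using e by linarith
  qed (use r(1) in auto)
qed

lemma valuation_if_eq_integral:
  fixes V :: "(real^'n) set \<Rightarrow> real"
  assumes \<theta>: "continuous_on {0..} \<theta>"
    and V: "\<And>K. K \<in> star_bodies \<Longrightarrow> V K = integral_functional \<theta> (radial_function K)"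
  shows "radial_continuous V" "rotation_invariant V" "valuation V"
proof -
  note R = radial_function_in_radial_maps
  \<comment> \<open>\<open>radial_function (body_of f)\<close> and \<open>f\<close> need agree only
    on the sphere, which suffices under the integral.\<close>
  have Vb: "V (body_of f) = integral_functional \<theta> f" if "f \<in> radial_maps" for f
    using V[OF body_of_in_star_bodies[OF that]] integral_functional_cong[OF radial_function_body_of[OF that]]
    by simp
  show "radial_continuous V"
    unfolding radial_continuous_def
  proof (intro ballI allI impI)
    fix K :: "(real^'n) set" and e :: real assume K: "K \<in> star_bodies" and e: "0 < e"
    obtain d where d: "0 < d" "\<forall>g\<in>radial_maps. (\<forall>t\<in>unit_sphere. \<bar>radial_function K t - g t\<bar> < d) \<longrightarrow>
        \<bar>integral_functional \<theta> g - integral_functional \<theta> (radial_function K)\<bar> < e"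
      using integral_functional_continuous[OF \<theta> R[OF K] e] by blast
    then show "\<exists>d>0. \<forall>L\<in>star_bodies. radial_dist K L < d \<longrightarrow> \<bar>V L - V K\<bar> < e"
      using radial_dist_less_imp[OF K] by (intro exI[of _ d]) (auto simp: V K R)
  qed
  show "rotation_invariant V"
    unfolding rotation_invariant_def
  proof (intro ballI allI impI)
    fix K :: "(real^'n) set" and A :: "real^'n^'n" assume K: "K \<in> star_bodies" and A: "rotation_matrix A"
    then have o: "orthogonal_matrix A" "orthogonal_matrix (transpose A)"
      by (simp_all add: rotation_matrix_def)
    have "(*v) A ` K = body_of (\<lambda>t. radial_function K (transpose A *v t))"
      using body_of_rotate[OF o(1), of "radial_function K"] body_of_radial_function[OF K] by simp
    then show "V ((*v) A ` K) = V K"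
      using Vb[OF rotate_in_radial_maps[OF R[OF K] o(2)]] V[OF K]
        integral_functional_invariant[OF \<theta> R[OF K] o(2)] by simp
  qed
  show "valuation V"
    unfolding valuation_def
  proof (intro ballI)
    fix K L :: "(real^'n) set" assume K: "K \<in> star_bodies" and L: "L \<in> star_bodies"
    note KL = max_min_in_radial_maps[OF R[OF K] R[OF L]]
    have "K \<union> L = body_of (\<lambda>t. max (radial_function K t) (radial_function L t))"
      "K \<inter> L = body_of (\<lambda>t. min (radial_function K t) (radial_function L t))"
      using body_of_Un[of "radial_function K" "radial_function L"] body_of_Int[OF R[OF K] R[OF L]]
      by (simp_all add: body_of_radial_function K L)
    then show "V (K \<union> L) + V (K \<inter> L) = V K + V L"
      using Vb[OF KL(1)] Vb[OF KL(2)] V[OF K] V[OF L]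
        integral_functional_modular[OF \<theta> R[OF K] R[OF L]] by simp
  qed
qed

section \<open>Integral representation of invariant valuations\<close>

lemma radial_continuousD:
  assumes V: "radial_continuous V" and f: "f \<in> radial_maps" and e: "0 < e"
  shows "\<exists>d>0. \<forall>g\<in>radial_maps. (\<forall>t\<in>unit_sphere. \<bar>f t - g t\<bar> < d) \<longrightarrow>
    \<bar>V (body_of g) - V (body_of f)\<bar> < e"
proof -
  obtain d where d: "0 < d"
    "\<And>L. \<lbrakk>L \<in> star_bodies; radial_dist (body_of f) L < d\<rbrakk> \<Longrightarrow> \<bar>V L - V (body_of f)\<bar> < e"
    using V body_of_in_star_bodies[OF f] e unfolding radial_continuous_def by meson
  \<comment> \<open>\<open>radial_dist_le\<close> yields a non-strict bound; \<open>d/2\<close>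
    keeps it below \<open>d\<close>.\<close>
  show ?thesis
  proof (intro exI[of _ "d/2"] conjI ballI impI)
    fix g assume g: "g \<in> radial_maps" and "\<forall>t\<in>unit_sphere. \<bar>f t - g t\<bar> < d/2"
    then have "radial_dist (body_of f) (body_of g) \<le> d/2"
      using f by (intro radial_dist_le body_of_in_star_bodies) (auto simp: radial_function_body_of less_imp_le)
    then show "\<bar>V (body_of g) - V (body_of f)\<bar> < e"
      using d body_of_in_star_bodies[OF g] by simp
  qed (use d(1) in simp)
qed

text \<open>The choice of \<open>\<theta>\<close> is forced, because the integral over a constant
  radial function \<open>c\<close> is \<open>\<theta> c\<close>. For negative \<open>c\<close> the
  set \<open>body_of (\<lambda>_. c)\<close> is empty, and nothing is claimed there.\<close>

lemma eq_integral_if_valuation: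
  fixes V :: "(real^'n) set \<Rightarrow> real"
  assumes n: "2 \<le> CARD('n)" and inv: "rotation_invariant V" and cont: "radial_continuous V"
    and val: "valuation V"
  defines "\<theta> \<equiv> \<lambda>c. V (body_of (\<lambda>_. c))"
  shows "continuous_on {0..} \<theta>"
    and "K \<in> star_bodies \<Longrightarrow> V K = integral_functional \<theta> (radial_function K)"
proof -
  have const: "(\<lambda>t. c) \<in> radial_maps" if "0 \<le> c" for c using that by (simp add: radial_maps_def)
  show \<theta>: "continuous_on {0..} \<theta>"
    unfolding continuous_on_iff
  proof (intro ballI allI impI)
    fix c e :: real assume c: "c \<in> {0..}" and e: "0 < e"
    then have "(\<lambda>t :: real^'n. c) \<in> radial_maps" by (intro const) simp
    from radial_continuousD[OF cont this e] obtain d where d: "0 < d"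
      "\<forall>g\<in>radial_maps. (\<forall>t\<in>unit_sphere. \<bar>c - g t\<bar> < d) \<longrightarrow>
        \<bar>V (body_of g) - V (body_of (\<lambda>_. c))\<bar> < e" by blast
    have "dist (\<theta> x) (\<theta> c) < e" if "x \<in> {0..}" "dist x c < d" for x
      using d(2)[rule_format, OF const[of x]] that
      by (simp add: \<theta>_def dist_real_def abs_minus_commute)
    with d(1) show "\<exists>d>0. \<forall>x'\<in>{0..}. dist x' c < d \<longrightarrow> dist (\<theta> x') (\<theta> c) < e" by blast
  qed
  \<comment> \<open>Both terms are modular, continuous and invariant under rotations, and these
    properties are inherited by differences.\<close>
  interpret invariant_functional "\<lambda>f. V (body_of f) - integral_functional \<theta> f"
  proof
    fix f g :: "real^'n \<Rightarrow> real" assume f: "f \<in> radial_maps" and g: "g \<in> radial_maps"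
    have "V (body_of f \<union> body_of g) + V (body_of f \<inter> body_of g) = V (body_of f) + V (body_of g)"
      using val f g by (simp add: valuation_def body_of_in_star_bodies)
    then show "V (body_of (\<lambda>t. max (f t) (g t))) - integral_functional \<theta> (\<lambda>t. max (f t) (g t)) +
        (V (body_of (\<lambda>t. min (f t) (g t))) - integral_functional \<theta> (\<lambda>t. min (f t) (g t))) =
        V (body_of f) - integral_functional \<theta> f + (V (body_of g) - integral_functional \<theta> g)"
      using integral_functional_modular[OF \<theta> f g] by (simp add: body_of_Un body_of_Int[OF f g])
  next
    fix f :: "real^'n \<Rightarrow> real" and e :: real assume f: "f \<in> radial_maps" and e: "0 < e"
    then have e2: "0 < e/2" by simp
    obtain d1 where d1: "0 < d1" "\<forall>g\<in>radial_maps. (\<forall>t\<in>unit_sphere. \<bar>f t - g t\<bar> < d1) \<longrightarrow>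
        \<bar>V (body_of g) - V (body_of f)\<bar> < e/2"
      using radial_continuousD[OF cont f e2] by blast
    obtain d2 where d2: "0 < d2" "\<forall>g\<in>radial_maps. (\<forall>t\<in>unit_sphere. \<bar>f t - g t\<bar> < d2) \<longrightarrow>
        \<bar>integral_functional \<theta> g - integral_functional \<theta> f\<bar> < e/2"
      using integral_functional_continuous[OF \<theta> f e2] by blast
    show "\<exists>d>0. \<forall>g\<in>radial_maps. (\<forall>t\<in>unit_sphere. \<bar>f t - g t\<bar> < d) \<longrightarrow>
        \<bar>V (body_of g) - integral_functional \<theta> g - (V (body_of f) - integral_functional \<theta> f)\<bar> < e"
    proof (intro exI[of _ "min d1 d2"] conjI ballI impI)
      fix g assume "g \<in> radial_maps" "\<forall>t\<in>unit_sphere. \<bar>f t - g t\<bar> < min d1 d2"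
      then have "\<bar>V (body_of g) - V (body_of f)\<bar> < e/2"
        "\<bar>integral_functional \<theta> g - integral_functional \<theta> f\<bar> < e/2"
        using d1(2) d2(2) by auto
      then show "\<bar>V (body_of g) - integral_functional \<theta> g - (V (body_of f) - integral_functional \<theta> f)\<bar> < e"
        by linarith
    qed (use d1 d2 in simp)
  next
    fix f :: "real^'n \<Rightarrow> real" and A :: "real^'n^'n"
    assume f: "f \<in> radial_maps" and A: "rotation_matrix A"
    have o: "orthogonal_matrix A" using A by (simp add: rotation_matrix_def)
    \<comment> \<open>Composing with \<open>A\<close> rotates the body by the inverse of
      \<open>A\<close>, which is again a rotation.\<close>
    have "body_of (\<lambda>t. f (A *v t)) = (*v) (transpose A) ` body_of f"
      using body_of_rotate[of "transpose A" f] o by simp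
    then have "V (body_of (\<lambda>t. f (A *v t))) = V (body_of f)"
      using inv rotation_matrix_transpose[OF A] body_of_in_star_bodies[OF f]
      by (simp add: rotation_invariant_def del: transpose_matrix_vector)
    then show "V (body_of (\<lambda>t. f (A *v t))) - integral_functional \<theta> (\<lambda>t. f (A *v t)) =
        V (body_of f) - integral_functional \<theta> f"
      using integral_functional_invariant[OF \<theta> f o] by simp
  qed (rule n)
  assume K: "K \<in> star_bodies"
  \<comment> \<open>On constants the difference vanishes by the choice of \<open>\<theta>\<close>,
    so it vanishes identically.\<close>
  have "V (body_of (radial_function K)) - integral_functional \<theta> (radial_function K) = 0"
    by (rule eq_0_if_null_on_constants[OF _ radial_function_in_radial_maps[OF K]])
       (simp add: integral_functional_const \<theta>_def)
  then show "V K = integral_functional \<theta> (radial_function K)"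
    by (simp add: body_of_radial_function[OF K])
qed

text \<open>The bound on \<open>CARD('n)\<close> makes rotations transitive on the sphere. On the
  line the identity is the only rotation, and \<open>V K = radial_function K t\<close> for a fixed
  unit vector \<open>t\<close> meets the other conditions without being of integral form.\<close>

theorem corollary1p2:
  shows "(\<forall>V :: (real^'n) set \<Rightarrow> real.
            CARD('n) \<ge> 2 \<and> rotation_invariant V \<and> radial_continuous V \<and> valuation V \<longrightarrow>
            (\<exists>\<theta> :: real \<Rightarrow> real. continuous_on {0..} \<theta> \<and>
               (\<forall>K\<in>star_bodies.
                  V K = (\<integral>t. \<theta> (radial_function K t) \<partial>normalized_surface_measure))))
       \<and> (\<forall>(\<theta> :: real \<Rightarrow> real) (V :: (real^'n) set \<Rightarrow> real).
            continuous_on {0..} \<theta> \<and>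
            (\<forall>K\<in>star_bodies.
               V K = (\<integral>t. \<theta> (radial_function K t) \<partial>normalized_surface_measure)) \<longrightarrow>
            radial_continuous V \<and> rotation_invariant V \<and> valuation V)"
  unfolding integral_functional_def[symmetric]
  using eq_integral_if_valuation valuation_if_eq_integral by blast

end
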